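(* $\mathbf{InqB}=\mathbf{InqKhL}$; that is, for every $\alpha\in\mathbf{PL}$, $\alpha$ is supported by every state in every model if and only if $M,w\vDash\mathsf{Kh}\alpha$ for every model $M$ and every world $w$ of $M$.
   Context: Fix a countable set $\mathbf{P}$ of proposition letters. $\mathbf{PL}$ is the set of formulas $\alpha::=p\mid\bot\mid(\alpha\land\alpha)\mid(\alpha\lor\alpha)\mid(\alpha\to\alpha)$ with $p\in\mathbf{P}$. A model is $M=\langle W,V\rangle$ with $W$ a non-empty set (of worlds) and $V:W\to\wp(\mathbf{P})$. Inquisitive semantics. A state in $M$ is any subset $s\subseteq W$ (possibly empty). Support $M,s\Vdash\alpha$ is defined by: $M,s\Vdash p$ iff $p\in V(w)$ for all $w\in s$; $M,s\Vdash\bot$ iff $s=\varnothing$; $M,s\Vdash\alpha\land\beta$ iff $M,s\Vdash\alpha$ and $M,s\Vdash\beta$; $M,s\Vdash\alpha\lor\beta$ iff $M,s\Vdash\alpha$ or $M,s\Vdash\beta$; $M,s\Vdash\alpha\to\beta$ iff for all $t\subseteq s$, $M,t\Vdash\alpha$ implies $M,t\Vdash\beta$. $\mathbf{InqB}$ (inquisitive logic) is the set of $\alpha\in\mathbf{PL}$ supported by all states in all models. Know-how semantics. The resolution space $S(\alpha)$ is defined by: $S(p)=\{p\}$; $S(\bot)=\{\bot\}$; $S(\alpha\lor\beta)=(S(\alpha)\times\{0\})\cup(S(\beta)\times\{1\})$; $S(\alpha\land\beta)=S(\alpha)\times S(\beta)$; $S(\alpha\to\beta)=S(\beta)^{S(\alpha)}$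 (all functions from $S(\alpha)$ to $S(\beta)$). For a world $w$ of $M$, the set of actual resolutions $R(w,\alpha)\subseteq S(\alpha)$ is: $R(w,\bot)=\varnothing$; $R(w,p)=\{p\}$ if $p\in V(w)$ and $\varnothing$ otherwise; $R(w,\alpha\lor\beta)=(R(w,\alpha)\times\{0\})\cup(R(w,\beta)\times\{1\})$; $R(w,\alpha\land\beta)=R(w,\alpha)\times R(w,\beta)$; $R(w,\alpha\to\beta)=\{f\in S(\beta)^{S(\alpha)}\mid f[R(w,\alpha)]\subseteq R(w,\beta)\}$. For $w\in W$: $M,w\vDash\mathsf{Kh}\alpha$ iff there is $x\in S(\alpha)$ such that $x\in R(v,\alpha)$ for all $v\in W$. $\mathbf{InqKhL}$ is the set of $\alpha\in\mathbf{PL}$ such that $\mathsf{Kh}\alpha$ is valid, i.e. $M,w\vDash\mathsf{Kh}\alpha$ for every model $M$ and world $w$ of $M$. *)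

theory Defs
  imports "HOL-Library.FSet" "HOL-Library.FuncSet" "HOL-Library.Countable"
begin

datatype 'p form =
    Letter 'p
  | Falsum
  | Conj "'p form" "'p form"
  | Disj "'p form" "'p form"
  | Impl "'p form" "'p form"

text \<open>Only the values of \<open>val\<close> on \<open>worlds\<close> matter.\<close>

record ('w, 'p) model =
  worlds :: "'w set"
  val :: "'w \<Rightarrow> 'p set"

definition is_model :: "('w, 'p) model \<Rightarrow> bool" where
  "is_model M \<longleftrightarrow> worlds M \<noteq> {}"

primrec support :: "('w, 'p) model \<Rightarrow> 'w set \<Rightarrow> 'p form \<Rightarrow> bool" where
  "support M s (Letter p) \<longleftrightarrow> (\<forall>w\<in>s. p \<in> val M w)"
| "support M s Falsum \<longleftrightarrow> s = {}"
| "support M s (Conj a b) \<longleftrightarrow> support M s a \<and> support M s b"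
| "support M s (Disj a b) \<longleftrightarrow> support M s a \<or> support M s b"
| "support M s (Impl a b) \<longleftrightarrow> (\<forall>t\<subseteq>s. support M t a \<longrightarrow> support M t b)"

text \<open>
  HOL has no quantification over types, so a logic is indexed by the type \<open>'w\<close> from which
  worlds are drawn; a statement with \<open>'w\<close> left as a type variable covers models of every type.
\<close>

definition InqB :: "'w itself \<Rightarrow> 'p form set" where
  "InqB _ = {a. \<forall>M :: ('w, 'p) model. is_model M \<longrightarrow> (\<forall>s\<subseteq>worlds M. support M s a)}"

text \<open>
  A single type containing the resolutions of all formulas. A function between resolution
  spaces is represented by its graph; graphs in \<^typ>\<open>('r \<times> 'r) fset\<close> suffice since resolution
  spaces are finite (\<open>finite_resolutions\<close> below).
\<close>

datatype 'p resolution =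
    RLetter 'p
  | RFalsum
  | RTag "'p resolution" nat
  | RPair "'p resolution" "'p resolution"
  | RGraph "('p resolution \<times> 'p resolution) fset"

definition graph_on ::
  "'p resolution set \<Rightarrow> ('p resolution \<Rightarrow> 'p resolution) \<Rightarrow> 'p resolution" where
  "graph_on A f = RGraph (Abs_fset ((\<lambda>x. (x, f x)) ` A))"

lemma inj_on_graph_on:
  assumes "finite A"
  shows "inj_on (graph_on A) (A \<rightarrow>\<^sub>E B)"
proof (rule inj_onI)
  fix f g
  assume f: "f \<in> A \<rightarrow>\<^sub>E B" and g: "g \<in> A \<rightarrow>\<^sub>E B" and eq: "graph_on A f = graph_on A g"
  have "(\<lambda>x. (x, f x)) ` A = (\<lambda>x. (x, g x)) ` A"
    using eq assms by (simp add: graph_on_def Abs_fset_inject)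
  then have "f x = g x" if "x \<in> A" for x
    using that by auto
  then show "f = g"
    using f g by (rule PiE_ext[rotated 2])
qed

primrec resolutions :: "'p form \<Rightarrow> 'p resolution set" where
  "resolutions (Letter p) = {RLetter p}"
| "resolutions Falsum = {RFalsum}"
| "resolutions (Conj a b) = {RPair x y | x y. x \<in> resolutions a \<and> y \<in> resolutions b}"
| "resolutions (Disj a b) =
     {RTag x 0 | x. x \<in> resolutions a} \<union> {RTag y 1 | y. y \<in> resolutions b}"
| "resolutions (Impl a b) =
     {graph_on (resolutions a) f | f. f \<in> resolutions a \<rightarrow>\<^sub>E resolutions b}"

lemma finite_resolutions: "finite (resolutions a)"
proof (induction a)
  case (Conj a b)
  then show ?case by (simp add: finite_image_set2)
next
  case (Impl a b)
  then show ?case by (simp add: finite_image_set finite_PiE)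
qed simp_all

primrec actual_resolutions ::
  "('w, 'p) model \<Rightarrow> 'w \<Rightarrow> 'p form \<Rightarrow> 'p resolution set" where
  "actual_resolutions M w (Letter p) = (if p \<in> val M w then {RLetter p} else {})"
| "actual_resolutions M w Falsum = {}"
| "actual_resolutions M w (Conj a b) =
     {RPair x y | x y. x \<in> actual_resolutions M w a \<and> y \<in> actual_resolutions M w b}"
| "actual_resolutions M w (Disj a b) =
     {RTag x 0 | x. x \<in> actual_resolutions M w a} \<union>
     {RTag y 1 | y. y \<in> actual_resolutions M w b}"
| "actual_resolutions M w (Impl a b) =
     {graph_on (resolutions a) f | f.
        f \<in> resolutions a \<rightarrow>\<^sub>E resolutions b \<and>
        f ` actual_resolutions M w a \<subseteq> actual_resolutions M w b}"

text \<open>\<open>Kh\<close> is a global modality, so its truth value does not depend on the world \<open>w\<close>.\<close>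

definition sat_Kh :: "('w, 'p) model \<Rightarrow> 'w \<Rightarrow> 'p form \<Rightarrow> bool" where
  "sat_Kh M w a \<longleftrightarrow> (\<exists>x\<in>resolutions a. \<forall>v\<in>worlds M. x \<in> actual_resolutions M v a)"

definition InqKhL :: "'w itself \<Rightarrow> 'p form set" where
  "InqKhL _ = {a. \<forall>M :: ('w, 'p) model. is_model M \<longrightarrow> (\<forall>w\<in>worlds M. sat_Kh M w a)}"

end

theory Submission
  imports Defs
begin

text \<open>
  Support and knowing how agree model by model and state by state: a state supports a formula
  iff a single resolution is actual throughout it. For an implication, a method for \<open>b\<close> is picked
  for each resolution \<open>x\<close> of \<open>a\<close> from the largest substate in which \<open>x\<close> is actual.
\<close>

lemma actual_resolutions_subset: "actual_resolutions M w a \<subseteq> resolutions a"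
  by (induction a) auto

text \<open>The clause for \<open>Impl\<close> only asserts that some function has the given graph.
  As \<open>resolutions a\<close> is finite, \<open>graph_on\<close> is injective on the extensional
  functions, so that function is \<open>f\<close> itself.\<close>

lemma graph_on_in_actual_resolutions_Impl:
  assumes "f \<in> resolutions a \<rightarrow>\<^sub>E resolutions b"
  shows "graph_on (resolutions a) f \<in> actual_resolutions M w (Impl a b) \<longleftrightarrow>
    f ` actual_resolutions M w a \<subseteq> actual_resolutions M w b"
  using assms inj_on_graph_on[OF finite_resolutions, of a "resolutions b"]
  by (auto dest: inj_onD)

lemma support_iff_common_resolution:
  "support M s a \<longleftrightarrow> (\<exists>x\<in>resolutions a. \<forall>v\<in>s. x \<in> actual_resolutions M v a)"
\<comment> \<open>The state varies because implication tests substates of \<open>s\<close>. For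
  \<open>Falsum\<close>, \<open>RFalsum\<close> is a vacuous witness at the empty state and actual
  nowhere else.\<close>
proof (induction a arbitrary: s)
  case (Conj a b)
  have "(\<exists>z\<in>resolutions (Conj a b). P z) \<longleftrightarrow>
      (\<exists>x\<in>resolutions a. \<exists>y\<in>resolutions b. P (RPair x y))" for P
    unfolding resolutions.simps by blast
  then show ?case
    by (simp add: Conj.IH) blast
next
  case (Disj a b)
  have "(\<exists>z\<in>resolutions (Disj a b). P z) \<longleftrightarrow>
      (\<exists>x\<in>resolutions a. P (RTag x 0)) \<or> (\<exists>y\<in>resolutions b. P (RTag y 1))" for P
    unfolding resolutions.simps by blast
  then show ?case
    by (simp add: Disj.IH)
next
  case (Impl a b)
  show ?case
  proof
    assume L: "support M s (Impl a b)"
    let ?t = "\<lambda>x. {v \<in> s. x \<in> actual_resolutions M v a}"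
    \<comment> \<open>If \<open>x\<close> is actual nowhere in \<open>s\<close>, then
      \<open>?t x\<close> is empty and still yields a \<open>y\<close>; hence the choice below is
      total on \<open>resolutions a\<close>.\<close>
    have "\<exists>y. y \<in> resolutions b \<and> (\<forall>v\<in>?t x. y \<in> actual_resolutions M v b)"
      if "x \<in> resolutions a" for x
    proof -
      have "support M (?t x) a"
        unfolding Impl.IH(1) using that by (intro bexI[of _ x]) simp_all
      then have "support M (?t x) b"
        using L by simp
      then show ?thesis
        unfolding Impl.IH(2) by (simp only: Bex_def)
    qed
    then have "\<forall>x\<in>resolutions a. \<exists>y. y \<in> resolutions b \<and> (\<forall>v\<in>?t x. y \<in> actual_resolutions M v b)"
      by (rule ballI)
    from bchoice[OF this] obtain g where g: "\<forall>x\<in>resolutions a.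
        g x \<in> resolutions b \<and> (\<forall>v\<in>?t x. g x \<in> actual_resolutions M v b)" ..
    \<comment> \<open>Restriction makes the choice function extensional, as membership in the
      function space demands.\<close>
    define f where "f = restrict g (resolutions a)"
    have f: "f \<in> resolutions a \<rightarrow>\<^sub>E resolutions b"
      using g by (auto simp: f_def)
    have "graph_on (resolutions a) f \<in> actual_resolutions M v (Impl a b)" if "v \<in> s" for v
      unfolding graph_on_in_actual_resolutions_Impl[OF f]
    proof (rule image_subsetI)
      fix x
      assume x: "x \<in> actual_resolutions M v a"
      then have "x \<in> resolutions a"
        using actual_resolutions_subset by (rule subsetD[rotated])
      then show "f x \<in> actual_resolutions M v b"
        using g x \<open>v \<in> s\<close> by (simp add: f_def)
    qed
    moreover have "graph_on (resolutions a) f \<in> resolutions (Impl a b)"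
      using f by auto
    ultimately show "\<exists>x\<in>resolutions (Impl a b). \<forall>v\<in>s. x \<in> actual_resolutions M v (Impl a b)"
      by blast
  next
    assume "\<exists>x\<in>resolutions (Impl a b). \<forall>v\<in>s. x \<in> actual_resolutions M v (Impl a b)"
    then obtain f where f: "f \<in> resolutions a \<rightarrow>\<^sub>E resolutions b"
      and mem: "\<forall>v\<in>s. graph_on (resolutions a) f \<in> actual_resolutions M v (Impl a b)"
      \<comment> \<open>Unfolding the actual resolutions here would produce a separate function for
        each world; kept folded, they all refer to the same \<open>f\<close>.\<close>
      by (auto simp del: actual_resolutions.simps)
    have act: "f ` actual_resolutions M v a \<subseteq> actual_resolutions M v b" if "v \<in> s" for v
      using mem[rule_format, OF that] by (rule graph_on_in_actual_resolutions_Impl[OF f, THEN iffD1])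
    \<comment> \<open>One \<open>x\<close> is actual throughout \<open>t\<close>, so the single
      value \<open>f x\<close> serves all of \<open>t\<close>.\<close>
    have "support M t b" if "t \<subseteq> s" "support M t a" for t
    proof -
      obtain x where x: "x \<in> resolutions a" "\<forall>v\<in>t. x \<in> actual_resolutions M v a"
        using \<open>support M t a\<close> Impl.IH(1) by blast
      then have "f x \<in> resolutions b" "\<forall>v\<in>t. f x \<in> actual_resolutions M v b"
        using f act \<open>t \<subseteq> s\<close> by (blast intro: PiE_mem)+
      then show ?thesis
        using Impl.IH(2) by blast
    qed
    then show "support M s (Impl a b)"
      by simp
  qed
qed auto

theorem corollary36:
  "(InqB TYPE('w) :: 'p::countable form set) = InqKhL TYPE('w)"
proof -
  \<comment> \<open>From left to right take \<open>s\<close> to be \<open>worlds M\<close>.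
    Conversely, a world exists at which to evaluate \<open>sat_Kh\<close>, and its resolution is
    common to every substate.\<close>
  have "(\<forall>s\<subseteq>worlds M. support M s a) \<longleftrightarrow> (\<forall>w\<in>worlds M. sat_Kh M w a)"
    if "is_model M" for M :: "('w, 'p) model" and a
    using that unfolding is_model_def sat_Kh_def support_iff_common_resolution by blast
  then show ?thesis
    by (auto simp: InqB_def InqKhL_def)
qed

end
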